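(* For every natural number $m$, there exist infinitely many natural numbers $n$ such that $n+1, n+2, \ldots, n+m$ are all Zumkeller numbers.
   Context: A natural number (positive integer) $n$ is a Zumkeller number if the set of its positive divisors can be partitioned into two subsets with equal sums; equivalently, $\sigma(n)/2$ is a sum of distinct positive divisors of $n$, where $\sigma(n)$ is the sum of the positive divisors of $n$. *)

theory Defs
  imports Main
begin

definition zumkeller :: "nat \<Rightarrow> bool" where
  "zumkeller n \<longleftrightarrow> n > 0 \<and>
     (\<exists>A B. A \<union> B = {d. d dvd n} \<and> A \<inter> B = {} \<and> \<Sum>A = \<Sum>B)"

end

theory Submission
  imports Defs "HOL-Number_Theory.Cong" "HOL-Computational_Algebra.Primes"
    "HOL-Analysis.Summation_Tests"
begin

text \<open>A Zumkeller number times a coprime number is Zumkeller, so by the Chinese remainder theorem,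
  applied to the congruences \<open>n + i \<equiv> z\<^sub>i (mod z\<^sub>i\<^sup>2)\<close>, it suffices to find arbitrarily many pairwise
  coprime Zumkeller numbers \<open>z\<^sub>i\<close>, that is, one coprime to any given \<open>N\<close>.

  Choose a prime \<open>q > N\<close>. Finitely many integers congruent to 1 modulo \<open>N q\<close> form a set \<open>F\<close> whose
  subset sums fill an interval of length at least \<open>q\<close>; let \<open>m\<close> be a common multiple of \<open>F\<close>. By
  divergence of the harmonic series there is \<open>w\<close> coprime to \<open>m q N\<close> with \<open>\<sigma>(w) \<ge> m w\<close>. If \<open>q^k \<ge> w\<close>,
  every divisor \<open>e > 1\<close> of \<open>q^k w\<close> has a smaller divisor \<open>e' \<ge> e / q\<close>, so the intervals
  \<open>e F\<close> can be glued: the products of elements of \<open>F\<close> with divisors of \<open>q^k w\<close> have subset sums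
  filling an interval of length at least \<open>\<sigma>(q^k w) \<ge> m q^k w =: n\<close>. All other divisors of \<open>n\<close> are at
  most \<open>n\<close> and can be added without creating gaps, and the interval then contains \<open>\<sigma>(n) / 2\<close>. Taking
  \<open>k\<close> odd makes \<open>\<sigma>(n)\<close> even.\<close>

section \<open>Divisors of a product of coprime numbers\<close>

lemma inj_on_mult_coprime_divisors:
  fixes x y :: nat
  assumes "coprime x y"
  shows "inj_on (\<lambda>(a, b). a * b) ({d. d dvd x} \<times> {d. d dvd y})"
proof (rule inj_onI, clarify)
  fix a b a' b' :: nat
  assume d: "a dvd x" "b dvd y" "a' dvd x" "b' dvd y" and eq: "a * b = a' * b'"
  have c: "coprime a b'" "coprime a' b" "coprime b a'" "coprime b' a"
    using d assms by (meson coprime_commute coprime_divisors)+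
  have "a dvd a'" "a' dvd a" "b dvd b'" "b' dvd b"
    using eq c by (metis coprime_dvd_mult_left_iff coprime_dvd_mult_right_iff dvd_triv_left dvd_triv_right)+
  then show "a = a' \<and> b = b'" by (simp add: dvd_antisym)
qed

lemma divisors_mult:
  fixes x y :: nat
  shows "{d. d dvd x * y} = (\<lambda>(a, b). a * b) ` ({d. d dvd x} \<times> {d. d dvd y})"
  by (auto dest: division_decomp intro: mult_dvd_mono)

lemma sum_image_mult:
  fixes A B :: "nat set"
  assumes "inj_on (\<lambda>(a, b). a * b) (A \<times> B)"
  shows "\<Sum>((\<lambda>(a, b). a * b) ` (A \<times> B)) = \<Sum>A * \<Sum>B"
  using assms by (simp add: sum.reindex sum_product sum.cartesian_product case_prod_unfold)

lemma sum_divisors_mult_coprime: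
  fixes x y :: nat
  assumes "coprime x y"
  shows "\<Sum>{d. d dvd x * y} = \<Sum>{d. d dvd x} * \<Sum>{d. d dvd y}"
  unfolding divisors_mult
  by (rule sum_image_mult) (rule inj_on_mult_coprime_divisors[OF assms])

text \<open>Multiplying both halves of a partition of the divisors of \<open>z\<close> by all
  divisors of \<open>y\<close> partitions the divisors of \<open>z * y\<close>; both half-sums are
  scaled by \<sigma>(y).\<close>

lemma zumkeller_mult_coprime:
  assumes "zumkeller z" "coprime z y" "y > 0"
  shows "zumkeller (z * y)"
proof -
  let ?f = "\<lambda>(a, b). a * b :: nat" and ?D = "{d. d dvd y}"
  obtain A B where AB: "A \<union> B = {d. d dvd z}" "A \<inter> B = {}" "\<Sum>A = \<Sum>B" and z: "z > 0"
    using assms(1) by (auto simp: zumkeller_def)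
  have inj: "inj_on ?f ((A \<union> B) \<times> ?D)"
    unfolding AB(1) by (rule inj_on_mult_coprime_divisors[OF assms(2)])
  then have injA: "inj_on ?f (A \<times> ?D)" and injB: "inj_on ?f (B \<times> ?D)"
    by (auto intro: inj_on_subset)
  have "?f ` (A \<times> ?D) \<union> ?f ` (B \<times> ?D) = {d. d dvd z * y}"
    unfolding divisors_mult AB(1)[symmetric] by blast
  moreover have "?f ` (A \<times> ?D) \<inter> ?f ` (B \<times> ?D) = ?f ` ((A \<times> ?D) \<inter> (B \<times> ?D))"
    by (rule inj_on_image_Int[OF inj, symmetric]) auto
  then have "?f ` (A \<times> ?D) \<inter> ?f ` (B \<times> ?D) = {}"
    using AB(2) by auto
  moreover have "\<Sum>(?f ` (A \<times> ?D)) = \<Sum>(?f ` (B \<times> ?D))"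
    using AB(3) by (simp only: sum_image_mult[OF injA] sum_image_mult[OF injB])
  ultimately show ?thesis
    using z assms(3) unfolding zumkeller_def by (metis nat_0_less_mult_iff)
qed

text \<open>By multiplicativity, \<sigma>(q^k) is a factor; it is a sum of \<open>k + 1\<close> odd
  powers, and \<open>k + 1\<close> is even.\<close>

lemma even_sum_divisors_odd_prime_power_mult:
  fixes q :: nat
  assumes "prime q" "odd q" "odd k" "coprime (q ^ k) y"
  shows "even (\<Sum>{d. d dvd q ^ k * y})"
proof -
  have "{d. d dvd q ^ k} = (\<lambda>i. q ^ i) ` {..k}"
    using divides_primepow_nat[OF assms(1)] by auto
  moreover have "inj_on (\<lambda>i. q ^ i) {..k}"
    using prime_gt_1_nat[OF assms(1)] by (auto intro: inj_onI)
  ultimately have "\<Sum>{d. d dvd q ^ k} = (\<Sum>i\<le>k. q ^ i)"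
    by (simp add: sum.reindex)
  moreover have "even (\<Sum>i\<le>k. q ^ i)"
    using assms(2,3) by (simp add: even_sum_iff)
  ultimately show ?thesis
    by (simp add: sum_divisors_mult_coprime[OF assms(4)])
qed

section \<open>Coprime numbers with large divisor sum\<close>

lemma coprime_1_plus_mult: "coprime (1 + t * M) (M :: nat)"
  by (rule coprimeI) (metis dvd_add_left_iff dvd_mult)

text \<open>Take \<open>w\<close> to be the product of the factors \<open>1 + i * M\<close> for
  \<open>i < K\<close>. The quotients of \<open>w\<close> by these factors are distinct divisors,
  and \<open>1 + i * M \<le> M * Suc i\<close> bounds their sum below by \<open>w / M\<close> times
  a harmonic sum.\<close>

lemma exists_coprime_abundant:
  fixes M C :: nat
  assumes "M > 0"
  shows "\<exists>w>0. coprime w M \<and> C * w \<le> \<Sum>{d. d dvd w}"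
proof -
  have "\<not> summable (\<lambda>i. inverse (real (Suc i)))"
    using not_summable_harmonic[where 'a = real]
      summable_Suc_iff[of "\<lambda>n. inverse (real n)"] by simp
  then obtain K where K: "(\<Sum>i<K. inverse (real (Suc i))) > real (C * M)"
    using bounded_imp_summable[of "\<lambda>i. inverse (real (Suc i))" "real (C * M)"]
    by (metis lessThan_Suc_atMost linorder_not_le inverse_nonnegative_iff_nonnegative of_nat_0_le_iff)
  define g where "g i = 1 + i * M" for i
  define w where "w = (\<Prod>i<K. g i)"
  have g0: "g i > 0" for i by (simp add: g_def)
  have w0: "w > 0" by (simp add: w_def g0 prod_pos)
  have gw: "g i dvd w" if "i < K" for i
    unfolding w_def using that by (intro dvd_prodI) auto
  have inj: "inj_on (\<lambda>i. w div g i) {..<K}"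
  proof (rule inj_onI)
    fix i j assume "i \<in> {..<K}" "j \<in> {..<K}" and e: "w div g i = w div g j"
    then have "(w div g i) * g i = w" "(w div g i) * g j = w"
      using gw by (metis dvd_div_mult_self lessThan_iff)+
    then have "g i = g j" using w0 by (metis mult_cancel1 mult_0 less_irrefl)
    then show "i = j" using assms by (simp add: g_def)
  qed
  have "real C * real w = (real w / real M) * real (C * M)"
    using assms by simp
  also have "\<dots> \<le> (real w / real M) * (\<Sum>i<K. inverse (real (Suc i)))"
    using K by (intro mult_left_mono) auto
  also have "\<dots> = (\<Sum>i<K. real w / real (M * Suc i))"
    by (simp add: sum_distrib_left field_simps)
  also have "\<dots> \<le> (\<Sum>i<K. real (w div g i))"
  proof (rule sum_mono)
    fix i assume "i \<in> {..<K}"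
    then have "real (w div g i) = real w / real (g i)"
      using gw by (simp add: real_of_nat_div)
    moreover have "g i \<le> M * Suc i" using assms by (simp add: g_def)
    ultimately show "real w / real (M * Suc i) \<le> real (w div g i)"
      using g0[of i] by (simp only:) (intro divide_left_mono mult_pos_pos; simp add: assms del: of_nat_mult)
  qed
  also have "\<dots> = real (\<Sum>((\<lambda>i. w div g i) ` {..<K}))"
    using inj by (simp add: sum.reindex)
  also have "\<dots> \<le> real (\<Sum>{d. d dvd w})"
    unfolding of_nat_le_iff
    using gw w0 by (intro sum_mono2) (auto, metis dvd_div_mult_self dvd_triv_left)
  finally have "C * w \<le> \<Sum>{d. d dvd w}"
    by (simp only: of_nat_mult[symmetric] of_nat_le_iff)
  moreover have "coprime w M"
    unfolding w_def
    by (rule prod_coprime_left) (simp only: g_def coprime_1_plus_mult)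
  ultimately show ?thesis using w0 by blast
qed

section \<open>Intervals of subset sums\<close>

definition covers :: "nat set \<Rightarrow> nat \<Rightarrow> nat \<Rightarrow> bool" where
  "covers F a b \<longleftrightarrow> (\<forall>x\<in>{a..b}. \<exists>S\<subseteq>F. \<Sum>S = x)"

text \<open>Each \<open>y\<close> in \<open>{a..b}\<close> shifts \<open>{c..d}\<close> by
  \<open>e * y\<close>; by \<open>gap\<close>, consecutive shifts leave no hole.\<close>

lemma covers_Un_scaled:
  assumes G: "covers G c d" and F: "covers F a b" and fin: "finite F" "finite G"
    and e: "e > 0" and disj: "G \<inter> (*) e ` F = {}" and gap: "c + e \<le> Suc d" and "a \<le> b"
  shows "covers (G \<union> (*) e ` F) (c + e * a) (d + e * b)"
  unfolding covers_def
proof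
  fix x assume x: "x \<in> {c + e * a..d + e * b}"
  \<comment> \<open>Greedy choice: the largest \<open>y \<le> b\<close> with
    \<open>c + e * y \<le> x\<close>. Either \<open>y = b\<close>, or less than \<open>e\<close>
    remains above \<open>c\<close>; both give \<open>x - e * y \<le> d\<close>.\<close>
  define y where "y = min b ((x - c) div e)"
  have le: "e * y \<le> x - c"
    unfolding y_def by (metis min.cobounded2 mult.commute mult_le_mono1 div_times_less_eq_dividend order_trans)
  have "a \<le> (x - c) div e"
    using x e by (simp add: less_eq_div_iff_mult_less_eq le_diff_conv2 mult.commute)
  then have y: "y \<in> {a..b}" using \<open>a \<le> b\<close> by (simp add: y_def)
  have "x - e * y \<le> d"
  proof (cases "b \<le> (x - c) div e")
    case True
    then have "y = b" by (simp add: y_def)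
    then show ?thesis using x by auto
  next
    case False
    then have "y = (x - c) div e" by (simp add: y_def)
    then have "x - c - e * y < e"
      using e by (simp add: minus_mult_div_eq_mod)
    then show ?thesis using gap le by linarith
  qed
  then have "x - e * y \<in> {c..d}" using le x by auto
  then obtain S where S: "S \<subseteq> G" "\<Sum>S = x - e * y"
    using G unfolding covers_def by blast
  obtain T where T: "T \<subseteq> F" "\<Sum>T = y"
    using F y unfolding covers_def by blast
  have "\<Sum>((*) e ` T) = e * y"
    using e T by (subst sum.reindex) (auto simp: sum_distrib_left inj_on_def)
  moreover have "\<Sum>(S \<union> (*) e ` T) = \<Sum>S + \<Sum>((*) e ` T)"
    using S T fin disj by (intro sum.union_disjoint) (auto intro: finite_subset)
  ultimately have "\<Sum>(S \<union> (*) e ` T) = x"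
    using S le x by auto
  then show "\<exists>S\<subseteq>G \<union> (*) e ` F. \<Sum>S = x"
    using S T by (intro exI[of _ "S \<union> (*) e ` T"]) auto
qed

text \<open>Each \<open>h\<close> is added as the copy of \<open>{1}\<close> scaled by
  \<open>h\<close>; the interval only grows, so the bound on the remaining elements
  persists.\<close>

lemma covers_Un_small:
  assumes "finite H" "finite G" "covers G c d" "G \<inter> H = {}" "\<forall>h\<in>H. 0 < h \<and> c + h \<le> Suc d"
  shows "covers (G \<union> H) c (d + \<Sum>H)"
  using assms
proof (induction H rule: finite_induct)
  case (insert h H)
  have "covers {1} 0 1"
    unfolding covers_def
  proof
    fix x :: nat assume "x \<in> {0..1}"
    then have "x = \<Sum>{} \<or> x = \<Sum>{1}" by auto
    then show "\<exists>S\<subseteq>{1}. \<Sum>S = x" by (metis empty_subsetI subset_refl)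
  qed
  then have "covers ((G \<union> H) \<union> (*) h ` {1}) (c + h * 0) (d + \<Sum>H + h * 1)"
    using insert by (intro covers_Un_scaled) auto
  then show ?case using insert by (simp add: add.commute add.left_commute)
qed simp

text \<open>The elements of \<open>E\<close> are added in increasing order. The interval reached so
  far has length at least \<open>q * \<Sum>E \<ge> q * e' \<ge> e\<close>, enough to attach the copy
  of \<open>F\<close> scaled by the next element \<open>e\<close>.\<close>

lemma covers_mult:
  assumes "finite E" and F: "covers F a b" "finite F" "a + q \<le> b"
    and "1 \<in> E" "0 \<notin> E" "inj_on (\<lambda>(x, y). x * y) (F \<times> E)"
    and "\<forall>e\<in>E. e \<noteq> 1 \<longrightarrow> (\<exists>e'\<in>E. e' < e \<and> e \<le> q * e')"
  shows "covers ((\<lambda>(x, y). x * y) ` (F \<times> E)) (a * \<Sum>E) (b * \<Sum>E)"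
  using assms(1,5-)
proof (induction E rule: finite_linorder_max_induct)
  case (insert e E)
  let ?f = "\<lambda>(x, y). x * y :: nat"
  show ?case
  proof (cases "e = 1")
    case True
    then have "E = {}" using insert by fastforce
    moreover have "?f ` (F \<times> {1}) = F" by force
    ultimately show ?thesis using True F by simp
  next
    case False
    then have E1: "1 \<in> E" using insert by auto
    have eE: "e \<notin> E" using insert by auto
    have fe: "?f ` (F \<times> {e}) = (*) e ` F" by (auto simp: image_iff mult.commute)
    have "covers (?f ` (F \<times> E)) (a * \<Sum>E) (b * \<Sum>E)"
    proof (rule insert.IH)
      show "inj_on ?f (F \<times> E)"
        using insert.prems(3) by (rule inj_on_subset) auto
      show "\<forall>x\<in>E. x \<noteq> 1 \<longrightarrow> (\<exists>e'\<in>E. e' < x \<and> x \<le> q * e')"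
        using insert.prems(4) insert.hyps(2) by (metis insert_iff order_less_asym)
    qed (use E1 insert in auto)
    moreover have "?f ` (F \<times> E) \<inter> ?f ` (F \<times> {e}) = ?f ` ((F \<times> E) \<inter> (F \<times> {e}))"
      by (rule inj_on_image_Int[OF insert.prems(3), symmetric]) auto
    then have "?f ` (F \<times> E) \<inter> (*) e ` F = {}"
      using eE unfolding fe by auto
    moreover have "a * \<Sum>E + e \<le> Suc (b * \<Sum>E)"
    proof -
      obtain e' where e': "e' \<in> E" "e \<le> q * e'"
        using insert.prems(4) False by (metis insert_iff order_less_irrefl)
      then have "e' \<le> \<Sum>E" using insert.hyps(1) by (intro member_le_sum) auto
      then have "e \<le> q * \<Sum>E" using e'(2) by (meson le_trans mult_le_mono2)
      then have "a * \<Sum>E + e \<le> (a + q) * \<Sum>E" by (simp add: algebra_simps)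
      also have "\<dots> \<le> b * \<Sum>E" using F(3) by (rule mult_le_mono1)
      finally show ?thesis by simp
    qed
    ultimately have "covers (?f ` (F \<times> E) \<union> (*) e ` F) (a * \<Sum>E + e * a) (b * \<Sum>E + e * b)"
      using F insert by (intro covers_Un_scaled) auto
    moreover have "?f ` (F \<times> insert e E) = ?f ` (F \<times> E) \<union> (*) e ` F"
      unfolding fe[symmetric] by auto
    ultimately show ?thesis
      using insert.hyps(1) eE by (simp add: algebra_simps)
  qed
qed simp

text \<open>The number of summands determines the residue modulo \<open>M\<close>; omitting one element from a
  block of consecutive indices adjusts the quotient.\<close>

lemma covers_arithmetic_progression:
  fixes M :: nat
  assumes "M > 0"
  shows "\<exists>K a b. covers ((\<lambda>t. 1 + t * M) ` {..<K}) a b \<and> a + M \<le> b"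
proof -
  \<comment> \<open>The construction below reaches the quotients \<open>z\<close> from
    \<open>S0 - c + M * M\<close> to \<open>S0\<close>. With \<open>c = M * M + 1\<close> these are
    two consecutive values, so \<open>b - a = M\<close>.\<close>
  define c where "c = M * M + 1"
  define S0 where "S0 = (\<Sum>t\<in>{M<..M + c}. t)"
  define a where "a = c + M * (S0 - c + M * M)"
  define b where "b = c + M * S0"
  have "(\<Sum>t\<in>{M<..M + c}. 1::nat) \<le> S0"
    unfolding S0_def by (rule sum_mono) auto
  then have S0: "c \<le> S0" by simp
  have "covers ((\<lambda>t. 1 + t * M) ` {..<Suc (M + c)}) a b"
    unfolding covers_def
  proof
    fix x assume x: "x \<in> {a..b}"
    define z where "z = (x - c) div M"
    define j where "j = (x - c) mod M"
    have xc: "x = c + (j + M * z)"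
      using x by (simp add: z_def j_def a_def)
    have j: "j < M" using assms by (simp add: j_def)
    have "M * (S0 - c + M * M) \<le> x - c" "x - c \<le> M * S0" using x by (auto simp: a_def b_def)
    then have z: "S0 - c + M * M \<le> z" "z \<le> S0"
      using assms unfolding z_def
      by (auto simp: less_eq_div_iff_mult_less_eq mult.commute dest: div_le_mono[where k = M])
    define s where "s = (\<Sum>t<j. t)"
    have "s \<le> (\<Sum>t<j. M)" unfolding s_def using j by (intro sum_mono) auto
    also have "\<dots> \<le> M * M" using j by simp
    finally have s: "s \<le> M * M" .
    \<comment> \<open>The omitted index \<open>M + i\<close> is determined by requiring index sum
      \<open>z\<close>: the block contributes \<open>S0 - i\<close> and the \<open>j\<close> small
      indices contribute \<open>s\<close>. The bound \<open>s \<le> M * M\<close> ensures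
      \<open>i \<le> c\<close>.\<close>
    define i where "i = s + S0 - z"
    have i: "i \<le> c" "s + S0 = i + z" using z s S0 unfolding i_def by linarith+
    let ?B = "{M..M + c} - {M + i}"
    define T where "T = {..<j} \<union> ?B"
    have blk: "\<Sum>{M..M + c} = M + S0"
      unfolding S0_def by (simp add: sum.head)
    have "\<Sum>?B = M + S0 - (M + i)"
      using i(1) by (subst sum_diff1_nat) (simp add: blk)
    moreover have "i \<le> S0" using i S0 by linarith
    ultimately have sB: "\<Sum>?B + i = S0" by simp
    have dis: "{..<j} \<inter> ?B = {}" using j by auto
    have "\<Sum>T = s + \<Sum>?B" unfolding T_def s_def using dis by (subst sum.union_disjoint) auto
    then have sT: "\<Sum>T = z" using sB i by linarith
    have "card T = j + c" unfolding T_def using dis i(1) by (subst card_Un_disjoint) auto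
    moreover have "\<Sum>((\<lambda>t. 1 + t * M) ` T) = (\<Sum>t\<in>T. 1 + t * M)"
      using assms by (subst sum.reindex) (auto simp: inj_on_def)
    moreover have "(\<Sum>t\<in>T. 1 + t * M) = card T + \<Sum>T * M"
      by (simp only: sum.distrib sum_distrib_right[symmetric] card_eq_sum)
    ultimately have "\<Sum>((\<lambda>t. 1 + t * M) ` T) = x"
      using sT xc by (simp add: mult.commute)
    moreover have "T \<subseteq> {..<Suc (M + c)}" using j by (auto simp: T_def)
    ultimately show "\<exists>S\<subseteq>(\<lambda>t. 1 + t * M) ` {..<Suc (M + c)}. \<Sum>S = x"
      by (intro exI[of _ "(\<lambda>t. 1 + t * M) ` T"] conjI image_mono)
  qed
  moreover have "a + M \<le> b"
  proof -
    have "S0 - c + M * M + 1 = S0" using S0 by (simp add: c_def)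
    then have "M * S0 = M * (S0 - c + M * M) + M" by (metis distrib_left mult.right_neutral)
    then show ?thesis by (simp add: a_def b_def)
  qed
  ultimately show ?thesis by blast
qed

section \<open>Zumkeller numbers coprime to a given number\<close>

text \<open>If \<open>q\<close> divides \<open>e\<close>, take \<open>e / q\<close>. Otherwise
  \<open>e\<close> divides \<open>w\<close>, so \<open>e \<le> q ^ k\<close>, and the largest power
  of \<open>q\<close> below \<open>e\<close> works.\<close>

lemma exists_smaller_divisor_within_ratio:
  fixes q k w :: nat
  assumes "prime q" "w > 0" "w \<le> q ^ k" "coprime q w" "e dvd q ^ k * w" "e \<noteq> 1"
  shows "\<exists>e'. e' dvd q ^ k * w \<and> e' < e \<and> e \<le> q * e'"
proof (cases "q dvd e")
  case True
  then obtain e' where e': "e = q * e'" by blast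
  have "e > 0" using assms(2,5) prime_gt_0_nat[OF assms(1)] by (intro Nat.gr0I) auto
  then have "e' < e" using e' prime_gt_1_nat[OF assms(1)] by simp
  moreover have "e' dvd q ^ k * w" using assms(5) e' dvd_mult_right by blast
  ultimately show ?thesis using e' by auto
next
  case False
  then have "coprime e (q ^ k)"
    using assms(1) by (metis coprime_commute coprime_power_right_iff prime_imp_coprime)
  then have "e dvd w" using assms(5) by (simp add: coprime_dvd_mult_right_iff)
  then have e: "e \<le> q ^ k" "e > 1"
    using assms(2,3,6) by (auto dest: dvd_imp_le intro: Suc_lessI dvd_pos_nat)
  define i where "i = (LEAST i. e \<le> q ^ i)"
  have i: "e \<le> q ^ i" "i \<le> k"
    unfolding i_def using e(1) by (auto intro: LeastI Least_le)
  then obtain h where h: "i = Suc h" using e(2) by (cases i) auto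
  then have "q ^ h < e"
    unfolding i_def using not_less_Least[of h "\<lambda>i. e \<le> q ^ i"] by (metis lessI not_le_imp_less)
  moreover have "q ^ h dvd q ^ k * w" using h i by (simp add: le_imp_power_dvd)
  ultimately show ?thesis using i h by auto
qed

text \<open>Divisors outside \<open>G\<close> are at most \<open>n \<le> d - c\<close>, so adding
  them extends the interval up to \<open>d + \<Sum>(?D - G)\<close>. The bounds on
  \<open>\<Sum>G\<close> place half the divisor sum between \<open>c\<close> and that end.\<close>

lemma zumkeller_if_covers_many:
  fixes n :: nat
  assumes G: "G \<subseteq> {d. d dvd n}" "covers G c d" and "n > 0" "even (\<Sum>{d. d dvd n})"
    and "c + n \<le> d" "d \<le> \<Sum>G" "2 * \<Sum>G \<le> \<Sum>{d. d dvd n}"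
  shows "zumkeller n"
proof -
  let ?D = "{d. d dvd n}" and ?\<sigma> = "\<Sum>{d. d dvd n}"
  have fin: "finite ?D" using assms by simp
  then have finG: "finite G" using G finite_subset by blast
  have "covers (G \<union> (?D - G)) c (d + \<Sum>(?D - G))"
    using assms fin finG
    by (intro covers_Un_small) (auto dest: dvd_imp_le intro: Nat.gr0I)
  moreover have "G \<union> (?D - G) = ?D" using G by blast
  ultimately have cov: "covers ?D c (d + \<Sum>(?D - G))" by simp
  have "?\<sigma> = \<Sum>(?D - G) + \<Sum>G"
    using G fin by (intro sum.subset_diff) auto
  then have "?\<sigma> div 2 \<in> {c..d + \<Sum>(?D - G)}" using assms by auto
  then obtain S where S: "S \<subseteq> ?D" "\<Sum>S = ?\<sigma> div 2"
    using cov unfolding covers_def by blast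
  moreover have "?\<sigma> = \<Sum>(?D - S) + \<Sum>S"
    using S fin by (intro sum.subset_diff) auto
  ultimately have "\<Sum>S = \<Sum>(?D - S)" using assms(4) by presburger
  then show ?thesis
    unfolding zumkeller_def using S assms by (intro conjI exI[of _ S] exI[of _ "?D - S"]) auto
qed

lemma exists_coprime_zumkeller:
  fixes N :: nat
  assumes "N > 0"
  shows "\<exists>z. zumkeller z \<and> coprime z N"
proof -
  obtain q where q: "prime q" "q > N + 2" using bigger_prime by blast
  have "odd q" using q prime_odd_nat by simp
  have qN: "coprime q N"
    using q assms by (intro prime_imp_coprime) (auto dest: dvd_imp_le)
  \<comment> \<open>Elements of \<open>F\<close> become coprime to both \<open>N\<close> and
    \<open>q\<close>, and \<open>M \<ge> q\<close> makes the interval long enough for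
    \<open>covers_mult\<close>.\<close>
  define M where "M = N * q"
  have M: "M > 0" "q \<le> M" using assms q by (auto simp: M_def)
  obtain K a b where cov: "covers ((\<lambda>t. 1 + t * M) ` {..<K}) a b" and ab: "a + M \<le> b"
    using covers_arithmetic_progression[OF M(1)] by blast
  define F where "F = (\<lambda>t. 1 + t * M) ` {..<K}"
  have finF: "finite F" by (simp add: F_def)
  have "b \<in> {a..b}" using ab by simp
  then obtain S where "S \<subseteq> F" "\<Sum>S = b"
    using cov unfolding covers_def F_def by blast
  then have bF: "b \<le> \<Sum>F" using finF sum_mono2 by blast
  define P where "P = \<Prod>F"
  \<comment> \<open>The exponent makes \<open>m \<ge> 2 * \<Sum>F\<close>, hence \<sigma>(m) is at
    least \<open>2 * \<Sum>F\<close>; this yields the bound on \<open>2 * \<Sum>G\<close> at the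
    end.\<close>
  define m where "m = P ^ (2 * \<Sum>F)"
  have "b > 0" using ab M by simp
  then have sF: "\<Sum>F > 0" using bF by simp
  have F0: "0 \<notin> F" by (auto simp: F_def)
  have "P \<noteq> 1"
  proof
    assume "P = 1"
    then have "F \<subseteq> {1}" unfolding P_def using finF dvd_prodI[of F _ id] by fastforce
    then have "\<Sum>F \<le> \<Sum>{1}" by (intro sum_mono2) auto
    then show False using bF ab M q by simp
  qed
  moreover have "P \<noteq> 0" using F0 finF by (simp add: P_def)
  ultimately have "2 \<le> P" by simp
  then have "2 ^ (2 * \<Sum>F) \<le> m" unfolding m_def by (rule power_mono) simp
  then have m: "2 * \<Sum>F \<le> m" by (meson less_exp less_imp_le order_trans)
  then have m0: "m > 0" using sF by simp
  have FP: "x dvd P" if "x \<in> F" for x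
    unfolding P_def using dvd_prodI[of F x id] that finF by simp
  then have Fm: "F \<subseteq> {d. d dvd m}"
    unfolding m_def using dvd_power[of "2 * \<Sum>F" P] sF by (metis (mono_tags, lifting) dvd_trans mem_Collect_eq mult_pos_pos pos2 subsetI)
  have "coprime P M"
    unfolding P_def F_def
    by (rule prod_coprime_left) (use coprime_1_plus_mult in auto)
  then have mM: "coprime m M" by (simp add: m_def)
  obtain w where w: "w > 0" "coprime w (m * M)" "m * w \<le> \<Sum>{d. d dvd w}"
    using exists_coprime_abundant[of "m * M" m] m0 M by auto
  \<comment> \<open>Odd for the parity of the divisor sum, and large enough for
    \<open>w \<le> q ^ k\<close>.\<close>
  define k where "k = 2 * w + 1"
  have "w < 2 ^ w" by (rule less_exp)
  also have "\<dots> \<le> q ^ k"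
    using q by (intro order_trans[OF power_mono[of 2 q w] power_increasing]) (auto simp: k_def)
  finally have wk: "w \<le> q ^ k" by simp
  have cop: "coprime m q" "coprime m N" "coprime w m" "coprime w q" "coprime w N"
    using mM w(2) by (auto simp: M_def)
  define u where "u = q ^ k * w"
  have u0: "u > 0" using w q by (simp add: u_def)
  have mu: "coprime m u" using cop by (simp add: u_def coprime_commute)
  let ?f = "\<lambda>(x, y). x * y :: nat" and ?E = "{d. d dvd u}"
  have inj: "inj_on ?f (F \<times> ?E)"
    using inj_on_mult_coprime_divisors[OF mu] by (rule inj_on_subset) (use Fm in auto)
  define G where "G = ?f ` (F \<times> ?E)"
  have covG: "covers G (a * \<Sum>?E) (b * \<Sum>?E)"
    unfolding G_def
  proof (rule covers_mult)
    show "a + q \<le> b" using ab M by simp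
    show "\<forall>e\<in>?E. e \<noteq> 1 \<longrightarrow> (\<exists>e'\<in>?E. e' < e \<and> e \<le> q * e')"
      using exists_smaller_divisor_within_ratio[OF q(1) w(1) wk] cop(4)
      by (auto simp: u_def coprime_commute)
  qed (use u0 inj finF cov in \<open>auto simp: F_def\<close>)
  have sG: "\<Sum>G = \<Sum>F * \<Sum>?E" unfolding G_def by (rule sum_image_mult[OF inj])
  have sigma_mu: "\<Sum>{d. d dvd m * u} = \<Sum>{d. d dvd m} * \<Sum>?E"
    by (rule sum_divisors_mult_coprime[OF mu])
  have le_sigma: "x \<le> \<Sum>{d. d dvd x}" if "x > 0" for x :: nat
    using that by (intro member_le_sum) auto
  have "zumkeller (m * u)"
  proof (rule zumkeller_if_covers_many[OF _ covG])
    show "G \<subseteq> {d. d dvd m * u}"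
      unfolding G_def divisors_mult using Fm by auto
    show "m * u > 0" using m0 u0 by simp
    have "coprime (q ^ k) (w * m)" using cop by (simp add: coprime_commute)
    then show "even (\<Sum>{d. d dvd m * u})"
      using even_sum_divisors_odd_prime_power_mult[OF q(1) \<open>odd q\<close>, of k "w * m"]
      by (simp add: k_def u_def mult_ac)
    \<comment> \<open>\<sigma>(u) is at least \<open>m * u\<close>, since \<sigma>(w) is at least
      \<open>m * w\<close>; as \<open>b - a \<ge> 1\<close>, the interval has length at least
      \<open>m * u\<close>.\<close>
    have "coprime (q ^ k) w" using cop by (simp add: coprime_commute)
    then have "q ^ k * (m * w) \<le> \<Sum>?E"
      unfolding u_def sum_divisors_mult_coprime[OF \<open>coprime (q ^ k) w\<close>]
      using w(3) le_sigma[of "q ^ k"] q by (intro mult_le_mono) auto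
    then have "m * u \<le> 1 * \<Sum>?E" by (simp add: u_def mult_ac)
    then have "a * \<Sum>?E + m * u \<le> (a + 1) * \<Sum>?E" by (simp add: algebra_simps)
    also have "\<dots> \<le> b * \<Sum>?E" using ab M by (intro mult_le_mono1) simp
    finally show "a * \<Sum>?E + m * u \<le> b * \<Sum>?E" .
    show "b * \<Sum>?E \<le> \<Sum>G" unfolding sG using bF by (rule mult_le_mono1)
    have "2 * \<Sum>F \<le> \<Sum>{d. d dvd m}" using m le_sigma[OF m0] by linarith
    then show "2 * \<Sum>G \<le> \<Sum>{d. d dvd m * u}"
      unfolding sG sigma_mu by (metis mult.assoc mult_le_mono1)
  qed
  moreover have "coprime (m * u) N" using cop qN by (simp add: u_def)
  ultimately show ?thesis by blast
qed

section \<open>Pairwise coprime families and the Chinese remainder theorem\<close>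

lemma exists_pairwise_coprime_zumkeller:
  fixes m :: nat
  shows "\<exists>z. (\<forall>i<m. zumkeller (z i)) \<and> (\<forall>i<m. \<forall>j<m. i \<noteq> j \<longrightarrow> coprime (z i) (z j))"
proof (induction m)
  case (Suc m)
  then obtain z where z: "\<forall>i<m. zumkeller (z i)"
    "\<forall>i<m. \<forall>j<m. i \<noteq> j \<longrightarrow> coprime (z i) (z j)" by blast
  \<comment> \<open>The new member is chosen coprime to the product of all earlier ones.\<close>
  have "(\<Prod>i<m. z i) > 0" using z(1) by (intro prod_pos) (auto simp: zumkeller_def)
  then obtain y where y: "zumkeller y" "coprime y (\<Prod>i<m. z i)"
    using exists_coprime_zumkeller by blast
  have "coprime y (z i)" if "i < m" for i
    using y(2) that by (meson coprime_divisors dvd_prodI dvd_refl finite_lessThan lessThan_iff)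
  then show ?case
    using z y(1) by (intro exI[of _ "z(m := y)"]) (auto simp: less_Suc_eq coprime_commute)
qed simp

text \<open>This gives \<open>z i \<ge> 2\<close>, hence \<open>z i < z i ^ 2\<close>, so
  \<open>z i\<close> is its own residue modulo \<open>z i ^ 2\<close>.\<close>

lemma not_zumkeller_1: "\<not> zumkeller 1"
proof
  assume "zumkeller 1"
  then obtain A B :: "nat set" where AB: "A \<union> B = {1}" "A \<inter> B = {}" "\<Sum>A = \<Sum>B"
    by (auto simp: zumkeller_def)
  have "finite (A \<union> B)" unfolding AB(1) by simp
  then have "finite A" "finite B" by simp_all
  then have "\<Sum>A + \<Sum>B = 1"
    using AB by (subst sum.union_disjoint[symmetric]) auto
  then show False using AB(3) by presburger
qed

theorem theorem3p4:
  fixes m :: nat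
  assumes "m > 0"
  shows "infinite {n :: nat. n > 0 \<and> (\<forall>k \<in> {1..m}. zumkeller (n + k))}"
proof -
  obtain z where z: "\<And>i. i < Suc m \<Longrightarrow> zumkeller (z i)"
    "\<And>i j. i < Suc m \<Longrightarrow> j < Suc m \<Longrightarrow> i \<noteq> j \<Longrightarrow> coprime (z i) (z j)"
    using exists_pairwise_coprime_zumkeller[of "Suc m"] by blast
  have z2: "z i \<ge> 2" if "i < Suc m" for i
  proof -
    have "z i > 0" "z i \<noteq> 1" using z(1)[OF that] not_zumkeller_1 by (auto simp: zumkeller_def)
    then show ?thesis by simp
  qed
  \<comment> \<open>The term \<open>i * (z i ^ 2 - 1)\<close> represents \<open>-i\<close> in the
    naturals. Residue \<open>z i\<close> modulo \<open>z i ^ 2\<close> forces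
    \<open>x + i = z i * (r * z i + 1)\<close>, with cofactor coprime to \<open>z i\<close>.\<close>
  have "\<exists>x. \<forall>i\<in>{1..m}. [x = z i + i * (z i ^ 2 - 1)] (mod z i ^ 2)"
    using z(2) by (intro chinese_remainder_nat) auto
  then obtain x where x: "\<And>i. i \<in> {1..m} \<Longrightarrow> [x = z i + i * (z i ^ 2 - 1)] (mod z i ^ 2)"
    by blast
  define Z where "Z = (\<Prod>i\<in>{1..m}. z i ^ 2)"
  have "Z > 0" unfolding Z_def using z2 by (intro prod_pos) (metis atLeastAtMost_iff less_Suc_eq_le pos2 order_less_le_trans zero_less_power)
  have zum: "zumkeller (x + t * Z + i)" if i: "i \<in> {1..m}" for t i
  proof -
    have im: "i < Suc m" using i by simp
    have "z i ^ 2 dvd Z" unfolding Z_def using i by (intro dvd_prodI) auto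
    then have "[x + t * Z + i = z i + i * (z i ^ 2 - 1) + 0 + i] (mod z i ^ 2)"
      using x[OF i] by (intro cong_add) (auto simp: cong_0_iff)
    also have "z i + i * (z i ^ 2 - 1) + 0 + i = z i + i * z i ^ 2"
      using z2[OF im] by (cases "z i ^ 2") auto
    also have "[z i + i * z i ^ 2 = z i] (mod z i ^ 2)" by (simp add: cong_def)
    finally have "(x + t * Z + i) mod z i ^ 2 = z i"
      using z2[OF im] by (simp add: cong_def power2_eq_square)
    then obtain r where "x + t * Z + i = z i ^ 2 * r + z i"
      by (metis mult_div_mod_eq)
    then have eq: "x + t * Z + i = z i * (r * z i + 1)"
      by (simp add: power2_eq_square algebra_simps)
    have "coprime (z i) (r * z i + 1)"
      using coprime_1_plus_mult[of r "z i"] by (simp add: coprime_commute)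
    then show ?thesis
      unfolding eq using z(1)[OF im] by (intro zumkeller_mult_coprime) auto
  qed
  have "\<exists>n>b. n \<in> {n. n > 0 \<and> (\<forall>k \<in> {1..m}. zumkeller (n + k))}" for b
  proof (intro exI conjI)
    have "Suc b * 1 \<le> Suc b * Z" using \<open>Z > 0\<close> by (intro mult_le_mono2) simp
    then show "b < x + Suc b * Z" by simp
    then show "x + Suc b * Z \<in> {n. n > 0 \<and> (\<forall>k \<in> {1..m}. zumkeller (n + k))}"
      using zum by (auto simp del: mult_Suc)
  qed
  then show ?thesis by (simp only: infinite_nat_iff_unbounded) blast
qed

end
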